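(* For every integer $n\ge 1$, $|\mathcal{S}_n(31;\,2\to 3)| = B^*_n$, where $B^*_n$ denotes the $n$-th Bessel number.
   Context: $[n]=\{1,\dots,n\}$, and $\mathcal{S}_n$ is the set of permutations $\pi=\pi_1\pi_2\cdots\pi_n$ of $[n]$ in one-line notation. The permutation $\hat\pi$: for $\pi\in\mathcal{S}_n$, $\hat\pi\in\mathcal{S}_n$ is the permutation whose cycle form is obtained from the word $\pi_1\cdots\pi_n$ by inserting a left parenthesis before each left-to-right maximum (an entry larger than all entries to its left) and a right parenthesis immediately before the next left-to-right maximum, or at the end of the word. A cycle $(c_1,c_2,\dots,c_s)$ means $c_1\mapsto c_2\mapsto\cdots\mapsto c_s\mapsto c_1$. Example: if $\pi=2537164$ then $\hat\pi=(2)(53)(7164)$. Arrow patterns: an arrow pattern of size $k$ is a pair $(\nu;H)$ where $\nu=\nu_1\cdots\nu_m$ is a word of distinct positive integers, $H$ is a collection of arrows $b_i\to c_i$, and the set of all integers appearing in $\nu$ or $H$ is $[k]$. A permutation $\pi\in\mathcal{S}_n$ contains $(\nu;H)$ if there are a set $X=\{x_1<x_2<\cdots<x_k\}\subseteq[n]$ and indices $t_1<\cdots<t_m$ such that $\pi_{t_1}\pi_{t_2}\cdots\pi_{t_m}=x_{\nu_1}x_{\nu_2}\cdots x_{\nu_m}$ and $\hat\pi(x_{b_i})=x_{c_i}$ for every arrow $b_i\to c_i$ in $H$. Otherwise $\pi$ avoids $(\nu;H)$. $\mathcal{S}_n(\nu;H)$ is the set of permutations in $\mathcal{S}_n$ avoiding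 $(\nu;H)$. The Bessel number $B^*_n$ (OEIS A006789; the values for $n=0,1,2,\dots$ are $1,1,2,5,14,43,143,509,\dots$) is the number of non-overlapping set partitions of $[n]$, i.e. set partitions having no two blocks $A,B$ with $\min A<\min B<\max A<\max B$. *)

theory Defs
  imports "HOL-Library.Disjoint_Sets" "HOL-Combinatorics.Combinatorics"
begin

text \<open>
  A permutation of \<open>[n] = {1..n}\<close> in one-line notation is a list in
  \<open>permutations_of_set {1..n}\<close>. List positions are counted from \<open>0\<close>, values from \<open>1\<close>.
\<close>

definition ltr_max :: "nat list \<Rightarrow> nat \<Rightarrow> bool" where
  "ltr_max w i \<longleftrightarrow> i < length w \<and> (\<forall>j<i. w ! j < w ! i)"

definition ltr_max_positions :: "nat list \<Rightarrow> nat list" where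
  "ltr_max_positions w = filter (ltr_max w) [0..<length w]"

text \<open>
  The factor starting at each left-to-right maximum (position \<open>i\<close>) and ending just before the
  next one (position \<open>j\<close>), or at the end of the word if there is no next one.
\<close>

definition ltr_cycles :: "nat list \<Rightarrow> nat list list" where
  "ltr_cycles w =
     (let ps = ltr_max_positions w
      in map2 (\<lambda>i j. take (j - i) (drop i w)) ps (tl ps @ [length w]))"

text \<open>
  \<open>cycle_of_list [c1, \<dots>, cs]\<close> sends \<open>c1 \<mapsto> c2 \<mapsto> \<dots> \<mapsto> cs \<mapsto> c1\<close>. If \<open>w\<close> has distinct
  entries, the cycles are disjoint and the order of composition does not matter.
\<close>

definition hat :: "nat list \<Rightarrow> nat \<Rightarrow> nat" where
  "hat w = foldr (\<circ>) (map cycle_of_list (ltr_cycles w)) id"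

lemma ltr_cycles_example: "ltr_cycles [2,5,3,7,1,6,4] = [[2], [5,3], [7,1,6,4]]"
  by code_simp

lemma hat_example: "map (hat [2,5,3,7,1,6,4]) [1,2,3,4,5,6,7] = [6,2,5,7,3,4,1]"
  by code_simp

text \<open>A pair \<open>(\<nu>, H)\<close>, where \<open>(b, c) \<in> H\<close> stands for the arrow \<open>b \<rightarrow> c\<close>.\<close>

type_synonym arrow_pattern = "nat list \<times> (nat \<times> nat) set"

definition arrow_letters :: "arrow_pattern \<Rightarrow> nat set" where
  "arrow_letters p = set (fst p) \<union> fst ` snd p \<union> snd ` snd p"

definition arrow_size :: "arrow_pattern \<Rightarrow> nat" where
  "arrow_size p = card (arrow_letters p)"

definition is_arrow_pattern :: "arrow_pattern \<Rightarrow> bool" where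
  "is_arrow_pattern p \<longleftrightarrow> distinct (fst p) \<and> arrow_letters p = {1..arrow_size p}"

text \<open>
  The set \<open>X = {x\<^sub>1 < \<dots> < x\<^sub>k}\<close> is given by its increasing enumeration \<open>x\<close>; the indices \<open>t\<close> are
  list positions.
\<close>

definition contains_arrow :: "nat list \<Rightarrow> arrow_pattern \<Rightarrow> bool" where
  "contains_arrow w p \<longleftrightarrow>
     (case p of (\<nu>, H) \<Rightarrow>
       \<exists>(x :: nat \<Rightarrow> nat) (t :: nat \<Rightarrow> nat).
         strict_mono_on {1..arrow_size p} x \<and>
         x ` {1..arrow_size p} \<subseteq> {1..length w} \<and>
         strict_mono_on {..<length \<nu>} t \<and>
         t ` {..<length \<nu>} \<subseteq> {..<length w} \<and>
         (\<forall>i<length \<nu>. w ! t i = x (\<nu> ! i)) \<and>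
         (\<forall>(b, c)\<in>H. hat w (x b) = x c))"

definition arrow_avoiders :: "nat \<Rightarrow> arrow_pattern \<Rightarrow> nat list set" where
  "arrow_avoiders n p = {w \<in> permutations_of_set {1..n}. \<not> contains_arrow w p}"

lemma is_arrow_pattern_31_2_3:
  "is_arrow_pattern ([3, 1], {(2, 3)})" "arrow_size ([3, 1], {(2, 3)}) = 3"
proof -
  have *: "arrow_letters ([3, 1], {(2, 3)}) = {1..3}"
    by (auto simp: arrow_letters_def)
  then show **: "arrow_size ([3, 1], {(2, 3)}) = 3"
    by (simp add: arrow_size_def)
  show "is_arrow_pattern ([3, 1], {(2, 3)})"
    unfolding is_arrow_pattern_def * ** by simp
qed

definition non_overlapping :: "nat set set \<Rightarrow> bool" where
  "non_overlapping P \<longleftrightarrow>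
     \<not> (\<exists>A\<in>P. \<exists>B\<in>P. Min A < Min B \<and> Min B < Max A \<and> Max A < Max B)"

definition bessel_number :: "nat \<Rightarrow> nat" where
  "bessel_number n = card {P. partition_on {1..n} P \<and> non_overlapping P}"

end

theory Submission
  imports Defs
begin

text \<open>
  Suppose \<open>\<pi>\<close> avoids the pattern. If \<open>b\<close> ends a nontrivial cycle, its image under \<open>hat \<pi>\<close> is the
  first entry of that cycle, so everything below \<open>b\<close> lies in earlier cycles and \<open>b\<close> is the minimum.
  An ascent inside a cycle would then put this minimum to the right of the top of the ascent, so
  every cycle is decreasing. Thus \<open>\<pi>\<close> amounts to a set partition whose blocks are listed by
  increasing maximum, and avoidance says that no nontrivial block \<open>B\<close> is nested in a block \<open>A\<close>,
  i.e. there is no \<open>min A < min B < max B < max A\<close>.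

  Non-nesting and non-overlapping partitions are equinumerous: build a partition by inserting
  \<open>1, 2, \<dots>, n\<close>, keeping track of the blocks that are still open. An element may be a singleton, open
  a block, continue any open block, or close a block; the last choice is forced, the block to be
  closed being the open one with the smallest minimum (non-nesting) or with the largest one
  (non-overlapping). So both numbers satisfy the same recurrence.
\<close>

section \<open>Counting partitions by open blocks\<close>

text \<open>
  A partition of \<open>[n]\<close> is encoded by the function sending each element to the minimum of its block,
  and everything outside \<open>[n]\<close> to \<open>0\<close>.
\<close>

definition block_labelling :: "nat \<Rightarrow> (nat \<Rightarrow> nat) \<Rightarrow> bool" where
  "block_labelling n f \<longleftrightarrow>
     (\<forall>i. i \<notin> {1..n} \<longrightarrow> f i = 0) \<and> (\<forall>i\<in>{1..n}. f i \<in> {1..i} \<and> f (f i) = f i)"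

definition labels :: "nat \<Rightarrow> (nat \<Rightarrow> nat) \<Rightarrow> nat set" where
  "labels n f = {a \<in> {1..n}. f a = a}"

text \<open>
  The arguments \<open>a, b, x, y\<close> stand for \<open>min A, min B, max A, max B\<close>. The forbidden configuration is
  \<open>B\<close> strictly nested in \<open>A\<close> if \<open>nest\<close> holds, and an overlap otherwise.
\<close>

definition conflict :: "bool \<Rightarrow> nat \<Rightarrow> nat \<Rightarrow> nat \<Rightarrow> nat \<Rightarrow> bool" where
  "conflict nest a b x y \<longleftrightarrow> a < b \<and> (if nest then b < y \<and> y < x else b < x \<and> x < y)"

text \<open>
  The blocks labelled by \<open>U\<close> are open, i.e. promised to receive an element beyond \<open>n\<close>;
  \<open>Suc n\<close> stands for their unknown maxima.
\<close>

definition block_end :: "nat \<Rightarrow> (nat \<Rightarrow> nat) \<Rightarrow> nat set \<Rightarrow> nat \<Rightarrow> nat" where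
  "block_end n f U a = (if a \<in> U then Suc n else Max {i. f i = a})"

definition open_states :: "bool \<Rightarrow> nat \<Rightarrow> nat \<Rightarrow> ((nat \<Rightarrow> nat) \<times> nat set) set" where
  "open_states nest n h = {(f, U). block_labelling n f \<and> U \<subseteq> labels n f \<and> card U = h \<and>
     (\<forall>a\<in>labels n f. \<forall>b\<in>labels n f.
        \<not> conflict nest a b (block_end n f U a) (block_end n f U b))}"

definition closing_label :: "bool \<Rightarrow> nat set \<Rightarrow> nat" where
  "closing_label nest U = (if nest then Min U else Max U)"

lemma block_labelling_0 [simp]: "block_labelling 0 f \<longleftrightarrow> f = (\<lambda>_. 0)"
  by (auto simp: block_labelling_def)

lemma block_labelling_outside: "block_labelling n f \<Longrightarrow> i \<notin> {1..n} \<Longrightarrow> f i = 0"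
  unfolding block_labelling_def by blast

lemma block_labelling_le: "block_labelling n f \<Longrightarrow> f i \<le> n"
  by (cases "i \<in> {1..n}") (fastforce simp: block_labelling_def)+

text \<open>Deleting the largest element changes no block minimum, apart from removing a singleton
  block. Outside \<open>{1..n}\<close> a labelling takes the default value 0, so the deletion is the
  update \<open>g(Suc n := 0)\<close>.\<close>

lemma block_labelling_Suc:
  "block_labelling (Suc n) g \<longleftrightarrow>
     (\<exists>f a. block_labelling n f \<and> g = f(Suc n := a) \<and> (a = Suc n \<or> a \<in> labels n f))"
proof
  assume g: "block_labelling (Suc n) g"
  let ?f = "g(Suc n := 0)"
  have le: "g i \<in> {1..i}" "g (g i) = g i" if "i \<in> {1..Suc n}" for i
    using g that unfolding block_labelling_def by auto
  have "block_labelling n ?f"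
    unfolding block_labelling_def
  proof (intro conjI allI ballI impI)
    fix i assume "i \<notin> {1..n}"
    then show "?f i = 0" using g by (cases "i = Suc n") (auto simp: block_labelling_def)
  next
    fix i assume "i \<in> {1..n}"
    then show "?f i \<in> {1..i}" "?f (?f i) = ?f i" using le[of i] by auto
  qed
  moreover have "g = ?f(Suc n := g (Suc n))"
    by simp
  moreover have "g (Suc n) = Suc n \<or> g (Suc n) \<in> labels n ?f"
    using le[of "Suc n", simplified] unfolding labels_def by (auto simp: le_Suc_eq)
  ultimately
  show "\<exists>f a. block_labelling n f \<and> g = f(Suc n := a) \<and> (a = Suc n \<or> a \<in> labels n f)"
    by blast
next
  assume "\<exists>f a. block_labelling n f \<and> g = f(Suc n := a) \<and> (a = Suc n \<or> a \<in> labels n f)"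
  then obtain f a where f: "block_labelling n f" and g: "g = f(Suc n := a)"
    and a: "a = Suc n \<or> a \<in> labels n f" by blast
  have "f i \<noteq> Suc n" for i
    using block_labelling_le[OF f, of i] by simp
  then show "block_labelling (Suc n) g"
    using f a unfolding block_labelling_def labels_def g by (auto simp: le_Suc_eq)
qed

lemma labels_update:
  "block_labelling n f \<Longrightarrow> a \<in> labels n f \<Longrightarrow> labels (Suc n) (f(Suc n := a)) = labels n f"
  "block_labelling n f \<Longrightarrow> labels (Suc n) (f(Suc n := Suc n)) = insert (Suc n) (labels n f)"
  unfolding labels_def by auto

lemma block_labelling_fibre:
  assumes "block_labelling n f" "a \<in> labels n f"
  shows "finite {i. f i = a}" "Max {i. f i = a} \<in> {a..n}"
proof -
  have sub: "{i. f i = a} \<subseteq> {1..n}"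
    using assms unfolding block_labelling_def labels_def by force
  then show fin: "finite {i. f i = a}"
    by (rule finite_subset) simp
  have "a \<in> {i. f i = a}"
    using assms by (simp add: labels_def)
  then show "Max {i. f i = a} \<in> {a..n}"
    using fin sub Max_in[OF fin] by (auto simp: subset_iff)
qed

lemma block_end_update:
  assumes "block_labelling n f" "a \<in> labels n f"
  shows "block_end (Suc n) (f(Suc n := c)) U a =
           (if a \<in> U then Suc (Suc n) else if c = a then Suc n else Max {i. f i = a})"
proof -
  have "f (Suc n) = 0" using assms by (simp add: block_labelling_def)
  then have *: "{i. (f(Suc n := c)) i = a} = (if c = a then insert (Suc n) {i. f i = a} else {i. f i = a})"
    using assms(2) by (auto simp: labels_def)
  have "Max (insert (Suc n) {i. f i = a}) = Suc n"
    using block_labelling_fibre[OF assms]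
    by (subst Max_insert2) (auto dest: Max_ge)
  then show ?thesis
    unfolding block_end_def * by simp
qed

lemma block_end_new:
  assumes "block_labelling n f"
  shows "block_end (Suc n) (f(Suc n := Suc n)) U (Suc n) = (if Suc n \<in> U then Suc (Suc n) else Suc n)"
proof -
  have "f i \<noteq> Suc n" for i
    using block_labelling_le[OF assms, of i] by simp
  then have "{i. (f(Suc n := Suc n)) i = Suc n} = {Suc n}"
    by auto
  then show ?thesis by (simp only: block_end_def Max_singleton)
qed

section \<open>The four ways of inserting the element n + 1\<close>

context
  fixes n :: nat and f :: "nat \<Rightarrow> nat" and U :: "nat set"
  assumes f: "block_labelling n f" and U: "U \<subseteq> labels n f"
begin

lemma finite_open_labels: "finite U"
  using U by (rule finite_subset) (simp add: labels_def)

lemma new_label_notin: "Suc n \<notin> U" "Suc n \<notin> labels n f"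
  using U by (auto simp: labels_def)

text \<open>Ends of open blocks move from \<open>Suc n\<close> to \<open>Suc (Suc n)\<close> and
  still exceed every other old end, so comparisons among old blocks persist. The new block has equal
  minimum and maximum, which the strict inequalities of a conflict exclude.\<close>

lemma state_singleton:
  "(f(Suc n := Suc n), U) \<in> open_states nest (Suc n) h \<longleftrightarrow> (f, U) \<in> open_states nest n h"
proof -
  have "block_labelling (Suc n) (f(Suc n := Suc n))"
    using f block_labelling_Suc by blast
  moreover have "conflict nest a b (block_end (Suc n) (f(Suc n := Suc n)) U a) (block_end (Suc n) (f(Suc n := Suc n)) U b)
    \<longleftrightarrow> conflict nest a b (block_end n f U a) (block_end n f U b)"
    if "a \<in> labels n f" "b \<in> labels n f" for a b
    using that block_labelling_fibre[OF f that(1)] block_labelling_fibre[OF f that(2)]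
    unfolding block_end_update[OF f that(1)] block_end_update[OF f that(2)] block_end_def[of n f] conflict_def
    by (auto simp: labels_def)
  moreover have "\<not> conflict nest a (Suc n) (block_end (Suc n) (f(Suc n := Suc n)) U a) (block_end (Suc n) (f(Suc n := Suc n)) U (Suc n))"
    "\<not> conflict nest (Suc n) a (block_end (Suc n) (f(Suc n := Suc n)) U (Suc n)) (block_end (Suc n) (f(Suc n := Suc n)) U a)"
    if "a \<in> labels n f" for a
    using that new_label_notin unfolding conflict_def block_end_new[OF f] by (auto simp: labels_def)
  moreover have "\<not> conflict nest (Suc n) (Suc n) x y" for x y
    by (simp add: conflict_def)
  ultimately show ?thesis
    using f U unfolding open_states_def by (auto simp: labels_update[OF f])
qed

text \<open>Every old block either ended at or before n, hence before the new block starts, or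
  shares the unknown end \<open>Suc (Suc n)\<close> with it. Neither situation satisfies the strict
  inequalities of a conflict.\<close>

lemma state_open:
  "(f(Suc n := Suc n), insert (Suc n) U) \<in> open_states nest (Suc n) (Suc h) \<longleftrightarrow> (f, U) \<in> open_states nest n h"
proof -
  let ?V = "insert (Suc n) U"
  have "block_labelling (Suc n) (f(Suc n := Suc n))"
    using f block_labelling_Suc by blast
  moreover have "conflict nest a b (block_end (Suc n) (f(Suc n := Suc n)) ?V a) (block_end (Suc n) (f(Suc n := Suc n)) ?V b)
    \<longleftrightarrow> conflict nest a b (block_end n f U a) (block_end n f U b)"
    if "a \<in> labels n f" "b \<in> labels n f" for a b
    using that block_labelling_fibre[OF f that(1)] block_labelling_fibre[OF f that(2)]
    unfolding block_end_update[OF f that(1)] block_end_update[OF f that(2)] block_end_def[of n f] conflict_def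
    by (auto simp: labels_def)
  moreover have "\<not> conflict nest a (Suc n) (block_end (Suc n) (f(Suc n := Suc n)) ?V a) (block_end (Suc n) (f(Suc n := Suc n)) ?V (Suc n))"
    "\<not> conflict nest (Suc n) a (block_end (Suc n) (f(Suc n := Suc n)) ?V (Suc n)) (block_end (Suc n) (f(Suc n := Suc n)) ?V a)"
    if "a \<in> labels n f" for a
    using that new_label_notin block_labelling_fibre[OF f that] unfolding conflict_def block_end_new[OF f] block_end_update[OF f that] by (auto simp: labels_def)
  moreover have "\<not> conflict nest (Suc n) (Suc n) x y" for x y
    by (simp add: conflict_def)
  moreover have "card ?V = Suc (card U)"
    using finite_open_labels new_label_notin by simp
  ultimately show ?thesis
    using f U unfolding open_states_def by (auto simp: labels_update[OF f])
qed

lemma state_transient: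
  assumes c: "c \<in> U"
  shows "(f(Suc n := c), U) \<in> open_states nest (Suc n) h \<longleftrightarrow> (f, U) \<in> open_states nest n h"
proof -
  have c': "c \<in> labels n f" using c U by auto
  then have "block_labelling (Suc n) (f(Suc n := c))"
    using f block_labelling_Suc by blast
  moreover have "conflict nest a b (block_end (Suc n) (f(Suc n := c)) U a) (block_end (Suc n) (f(Suc n := c)) U b)
    \<longleftrightarrow> conflict nest a b (block_end n f U a) (block_end n f U b)"
    if "a \<in> labels n f" "b \<in> labels n f" for a b
    using that c block_labelling_fibre[OF f that(1)] block_labelling_fibre[OF f that(2)]
    unfolding block_end_update[OF f that(1)] block_end_update[OF f that(2)] block_end_def[of n f] conflict_def
    by (auto simp: labels_def)
  ultimately show ?thesis
    using f U unfolding open_states_def by (auto simp: labels_update(1)[OF f c'])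
qed

lemma closing_label_iff:
  assumes c: "c \<in> U"
  shows "c = closing_label nest U \<longleftrightarrow> (\<forall>b\<in>U. if nest then c \<le> b else b \<le> c)"
  unfolding closing_label_def using c finite_open_labels
  by (auto intro!: Min_eqI[symmetric] Max_eqI[symmetric])

text \<open>Closing \<open>c\<close> breaks the ties between the ends of open blocks:
  \<open>c\<close> ends at \<open>Suc n\<close>, the others later. An open block with smaller
  minimum now contains \<open>c\<close> as a nested block, and one with larger minimum now overlaps
  \<open>c\<close>. Hence \<open>c\<close> must have the smallest, respectively the largest, open
  minimum.\<close>

lemma state_close:
  assumes c: "c \<in> U"
  shows "(f(Suc n := c), U - {c}) \<in> open_states nest (Suc n) h \<longleftrightarrow>
           (f, U) \<in> open_states nest n (Suc h) \<and> c = closing_label nest U"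
proof -
  let ?old = "\<lambda>a b. conflict nest a b (block_end n f U a) (block_end n f U b)"
  let ?new = "\<lambda>a b. conflict nest a b (block_end (Suc n) (f(Suc n := c)) (U - {c}) a)
                 (block_end (Suc n) (f(Suc n := c)) (U - {c}) b)"
  \<comment> \<open>The conflicts created by the closing. The block that now ends first is the one
    starting later for nesting, and the one starting earlier for overlapping.\<close>
  let ?extra = "\<lambda>a b. a < b \<and> a \<in> U \<and> b \<in> U \<and> c = (if nest then b else a)"
  have c': "c \<in> labels n f" using c U by auto
  then have bl: "block_labelling (Suc n) (f(Suc n := c))"
    using f block_labelling_Suc by blast
  have conf: "?new a b \<longleftrightarrow> ?old a b \<or> ?extra a b"
    if "a \<in> labels n f" "b \<in> labels n f" for a b
    using that c block_labelling_fibre[OF f that(1)] block_labelling_fibre[OF f that(2)]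
    unfolding block_end_update[OF f that(1)] block_end_update[OF f that(2)] block_end_def[of n f] conflict_def
    by (auto simp: labels_def)
  have closing: "c = closing_label nest U \<longleftrightarrow> (\<forall>a\<in>labels n f. \<forall>b\<in>labels n f. \<not> ?extra a b)"
    unfolding closing_label_iff[OF c] using U c' c by (auto simp: not_less)
  have card: "card U = Suc h \<longleftrightarrow> card (U - {c}) = h"
    using card_Suc_Diff1[OF finite_open_labels c] by linarith
  have "(f(Suc n := c), U - {c}) \<in> open_states nest (Suc n) h \<longleftrightarrow>
      card (U - {c}) = h \<and> (\<forall>a\<in>labels n f. \<forall>b\<in>labels n f. \<not> ?new a b)"
    using bl U unfolding open_states_def by (auto simp: labels_update(1)[OF f c'])
  also have "\<dots> \<longleftrightarrow> card U = Suc h \<and> (\<forall>a\<in>labels n f. \<forall>b\<in>labels n f. \<not> ?old a b) \<and>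
      c = closing_label nest U"
    unfolding closing card using conf by meson
  also have "\<dots> \<longleftrightarrow> (f, U) \<in> open_states nest n (Suc h) \<and> c = closing_label nest U"
    using f U unfolding open_states_def by auto
  finally show ?thesis .
qed

end

section \<open>The recurrence for the number of states\<close>

lemma open_states_Suc_cases:
  assumes "(g, V) \<in> open_states nest (Suc n) h"
  obtains
    (singleton) f U where "(f, U) \<in> open_states nest n h" "g = f(Suc n := Suc n)" "V = U"
  | (start) f U k where "h = Suc k" "(f, U) \<in> open_states nest n k" "g = f(Suc n := Suc n)" "V = insert (Suc n) U"
  | (transient) f U c where "(f, U) \<in> open_states nest n h" "c \<in> U" "g = f(Suc n := c)" "V = U"
  | (close) f U c where "(f, U) \<in> open_states nest n (Suc h)" "c = closing_label nest U"
      "g = f(Suc n := c)" "V = U - {c}"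
proof -
  have "block_labelling (Suc n) g" and V: "V \<subseteq> labels (Suc n) g" "card V = h"
    using assms by (auto simp: open_states_def)
  then obtain f c where f: "block_labelling n f" and g: "g = f(Suc n := c)"
    and c: "c = Suc n \<or> c \<in> labels n f"
    by (auto simp: block_labelling_Suc)
  show thesis
  proof (cases "c = Suc n")
    case True
    then have V': "V \<subseteq> insert (Suc n) (labels n f)"
      using V labels_update(2)[OF f] g by simp
    show thesis
    proof (cases "Suc n \<in> V")
      case True
      define U where "U = V - {Suc n}"
      have VU: "V = insert (Suc n) U" and U: "U \<subseteq> labels n f"
        using V' True by (auto simp: U_def)
      have "card V = Suc (card U)"
        using finite_open_labels[OF f U] new_label_notin[OF f U] VU by simp
      then obtain k where "h = Suc k" using V(2) by blast
      with start[of k f U] state_open[OF f U] assms VU g \<open>c = Suc n\<close> show thesis by simp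
    next
      case False
      then have "V \<subseteq> labels n f" using V' by auto
      with state_singleton[OF f this] singleton[of f V] assms g \<open>c = Suc n\<close> show thesis by simp
    qed
  next
    case False
    then have c: "c \<in> labels n f" using c by simp
    have V': "V \<subseteq> labels n f"
      using V labels_update(1)[OF f c] g by simp
    show thesis
    proof (cases "c \<in> V")
      case True
      with state_transient[OF f V' True] transient[of f V c] assms g show thesis by simp
    next
      case False
      \<comment> \<open>The element n + 1 has an old label that is no longer open, so it closed that
        block; reopening the block gives the previous state.\<close>
      define U where "U = insert c V"
      have U: "U \<subseteq> labels n f" "c \<in> U" "V = U - {c}"
        using V' c False by (auto simp: U_def)
      with state_close[OF f U(1,2)] close[of f U c] assms g show thesis by simp
    qed
  qed
qed

lemma closing_label_in: "finite U \<Longrightarrow> U \<noteq> {} \<Longrightarrow> closing_label nest U \<in> U"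
  by (simp add: closing_label_def)

lemma open_states_Suc:
  "open_states nest (Suc n) h =
     (\<lambda>(f, U). (f(Suc n := Suc n), U)) ` open_states nest n h \<union>
     (case h of 0 \<Rightarrow> {} | Suc k \<Rightarrow>
        (\<lambda>(f, U). (f(Suc n := Suc n), insert (Suc n) U)) ` open_states nest n k) \<union>
     (\<lambda>((f, U), c). (f(Suc n := c), U)) ` (SIGMA s : open_states nest n h. snd s) \<union>
     (\<lambda>(f, U). (f(Suc n := closing_label nest U), U - {closing_label nest U})) `
        open_states nest n (Suc h)"
  (is "_ = ?A \<union> ?B \<union> ?C \<union> ?D")
proof (intro equalityI subsetI)
  fix s assume "s \<in> open_states nest (Suc n) h"
  then obtain g V where s: "s = (g, V)" "(g, V) \<in> open_states nest (Suc n) h"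
    by (cases s) auto
  from s(2) show "s \<in> ?A \<union> ?B \<union> ?C \<union> ?D"
  proof (cases rule: open_states_Suc_cases)
    case (singleton f U)
    then have "s \<in> ?A" using s by (auto intro: rev_image_eqI)
    then show ?thesis by blast
  next
    case (start f U k)
    then have "s \<in> ?B" using s by (auto intro: rev_image_eqI)
    then show ?thesis by blast
  next
    case (transient f U c)
    then have "s \<in> ?C" using s by (auto intro!: rev_image_eqI[of "((f, U), c)"])
    then show ?thesis by blast
  next
    case (close f U c)
    then have "s \<in> ?D" using s by (auto intro: rev_image_eqI)
    then show ?thesis by blast
  qed
next
  have props: "block_labelling n f" "U \<subseteq> labels n f" "card U = k"
    if "(f, U) \<in> open_states nest n k" for f U k
    using that by (auto simp: open_states_def)
  fix s assume "s \<in> ?A \<union> ?B \<union> ?C \<union> ?D"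
  then consider "s \<in> ?A" | "s \<in> ?B" | "s \<in> ?C" | "s \<in> ?D" by blast
  then show "s \<in> open_states nest (Suc n) h"
  proof cases
    case 1
    then show ?thesis using state_singleton props by auto
  next
    case 2
    then show ?thesis using state_open props by (auto split: nat.splits)
  next
    case 3
    then show ?thesis using state_transient props by auto
  next
    case 4
    then obtain f U where fU: "(f, U) \<in> open_states nest n (Suc h)"
      and s: "s = (f(Suc n := closing_label nest U), U - {closing_label nest U})" by auto
    have "closing_label nest U \<in> U"
      using props[OF fU] finite_open_labels by (intro closing_label_in) auto
    then show ?thesis using s fU state_close[OF props(1,2)[OF fU]] by simp
  qed
qed

lemma labelling_update_eq:
  assumes "block_labelling n f" "block_labelling n f'" "f(Suc n := a) = f'(Suc n := b)"
  shows "f = f' \<and> a = b"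
proof -
  have "f (Suc n) = 0" "f' (Suc n) = 0"
    using assms by (auto simp: block_labelling_def)
  then show ?thesis
    using assms(3) by (metis fun_upd_same fun_upd_triv fun_upd_upd)
qed

text \<open>States are counted like weighted Motzkin paths, with the number of open blocks as
  height: up and down steps have weight 1, and level steps at height \<open>h\<close> have weight
  \<open>h + 1\<close>, one for a singleton and \<open>h\<close> for the choice of a block to
  continue. The weights do not depend on \<open>nest\<close>.\<close>

lemma finite_card_open_states_Suc:
  assumes fin: "\<And>k. finite (open_states nest n k)"
  shows "finite (open_states nest (Suc n) h)"
    "card (open_states nest (Suc n) h) =
       card (open_states nest n h) + (case h of 0 \<Rightarrow> 0 | Suc k \<Rightarrow> card (open_states nest n k)) +
       h * card (open_states nest n h) + card (open_states nest n (Suc h))"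
proof -
  let ?S = "open_states nest n"
  define A where "A = (\<lambda>(f, U). (f(Suc n := Suc n), U)) ` ?S h"
  define B where "B = (case h of 0 \<Rightarrow> {} | Suc k \<Rightarrow>
        (\<lambda>(f, U). (f(Suc n := Suc n), insert (Suc n) U)) ` ?S k)"
  \<comment> \<open>The Sigma type pairs a state with the open block that is continued; this is the
    source of the factor \<open>h\<close>.\<close>
  define C where "C = (\<lambda>((f, U), c). (f(Suc n := c), U)) ` (SIGMA s : ?S h. snd s)"
  define D where "D = (\<lambda>(f, U). (f(Suc n := closing_label nest U), U - {closing_label nest U})) ` ?S (Suc h)"
  have props: "block_labelling n f" "U \<subseteq> labels n f" "card U = k" "finite U" "Suc n \<notin> U"
    if "(f, U) \<in> ?S k" for f U k
    using that finite_open_labels[of n f U] by (auto simp: open_states_def labels_def)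
  have cl: "closing_label nest U \<in> U" "closing_label nest U \<noteq> Suc n"
    if "(f, U) \<in> ?S (Suc h)" for f U
  proof -
    show "closing_label nest U \<in> U"
      using props[OF that] by (intro closing_label_in) auto
    then show "closing_label nest U \<noteq> Suc n" using props[OF that] by auto
  qed
  have Suc: "open_states nest (Suc n) h = A \<union> B \<union> C \<union> D"
    unfolding A_def B_def C_def D_def by (rule open_states_Suc)
  have finSig: "finite (SIGMA s : ?S h. snd s)"
    using fin props(4) by (intro finite_SigmaI) auto
  have fins: "finite A" "finite B" "finite C" "finite D"
    unfolding A_def B_def C_def D_def using fin finSig by (auto split: nat.splits)
  then show "finite (open_states nest (Suc n) h)"
    unfolding Suc by simp
  \<comment> \<open>The four kinds of step are told apart by two questions: whether n + 1 is its own
    label, and whether its label is open afterwards.\<close>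
  have A: "s \<in> A \<Longrightarrow> fst s (Suc n) = Suc n \<and> Suc n \<notin> snd s"
   and B: "s \<in> B \<Longrightarrow> fst s (Suc n) = Suc n \<and> Suc n \<in> snd s"
   and C: "s \<in> C \<Longrightarrow> fst s (Suc n) \<noteq> Suc n \<and> fst s (Suc n) \<in> snd s"
   and D: "s \<in> D \<Longrightarrow> fst s (Suc n) \<noteq> Suc n \<and> fst s (Suc n) \<notin> snd s" for s
    unfolding A_def B_def C_def D_def using props cl by (auto split: nat.splits)
  have disj: "A \<inter> B = {}" "(A \<union> B) \<inter> C = {}" "(A \<union> B \<union> C) \<inter> D = {}"
    using A B C D by blast+
  have "card A = card (?S h)"
    unfolding A_def using labelling_update_eq props
    by (intro card_image inj_onI) (auto; blast)
  moreover have "card B = (case h of 0 \<Rightarrow> 0 | Suc k \<Rightarrow> card (?S k))"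
  proof (cases h)
    case (Suc k)
    have "inj_on (\<lambda>(f, U). (f(Suc n := Suc n), insert (Suc n) U)) (?S k)"
    proof (intro inj_onI, clarify, intro conjI)
      fix f U g V assume *: "(f, U) \<in> ?S k" "(g, V) \<in> ?S k"
        "f(Suc n := Suc n) = g(Suc n := Suc n)" "insert (Suc n) U = insert (Suc n) V"
      show "f = g" using labelling_update_eq[OF _ _ *(3)] props * by blast
      show "U = V" using *(4) props(5)[OF *(1)] props(5)[OF *(2)] by (simp add: insert_ident)
    qed
    then show ?thesis unfolding B_def Suc by (simp add: card_image)
  qed (simp add: B_def)
  moreover have "card C = h * card (?S h)"
  proof -
    have "inj_on (\<lambda>((f, U), c). (f(Suc n := c), U)) (SIGMA s : ?S h. snd s)"
    proof (intro inj_onI, clarsimp)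
      fix f c g d U assume *: "(f, U) \<in> ?S h" "(g, U) \<in> ?S h" "f(Suc n := c) = g(Suc n := d)"
      show "f = g \<and> c = d" using labelling_update_eq[OF _ _ *(3)] props * by blast
    qed
    then have "card C = card (SIGMA s : ?S h. snd s)"
      unfolding C_def by (rule card_image)
    also have "\<dots> = (\<Sum>s\<in>?S h. card (snd s))"
      using fin props(4) by (intro card_SigmaI) auto
    also have "\<dots> = (\<Sum>s\<in>?S h. h)"
      using props(3) by (intro sum.cong) auto
    finally show ?thesis by simp
  qed
  moreover have "card D = card (?S (Suc h))"
    unfolding D_def
  proof (intro card_image inj_onI, clarify, intro conjI)
    fix f U g V assume *: "(f, U) \<in> ?S (Suc h)" "(g, V) \<in> ?S (Suc h)"
      "f(Suc n := closing_label nest U) = g(Suc n := closing_label nest V)"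
      "U - {closing_label nest U} = V - {closing_label nest V}"
    have "f = g \<and> closing_label nest U = closing_label nest V"
      using labelling_update_eq[OF _ _ *(3)] props * by blast
    \<comment> \<open>The common closing label lies in both \<open>U\<close> and \<open>V\<close>,
      so putting it back recovers equal sets.\<close>
    then show "f = g" "U = V" using *(4) cl(1)[OF *(1)] cl(1)[OF *(2)] by auto
  qed
  ultimately show "card (open_states nest (Suc n) h) =
       card (?S h) + (case h of 0 \<Rightarrow> 0 | Suc k \<Rightarrow> card (?S k)) + h * card (?S h) + card (?S (Suc h))"
    unfolding Suc using fins disj by (simp add: card_Un_disjoint)
qed

lemma finite_open_states: "finite (open_states nest n h)"
proof (induction n arbitrary: h)
  case 0
  have "open_states nest 0 h \<subseteq> {(\<lambda>_. 0, {})}"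
    by (auto simp: open_states_def labels_def)
  then show ?case by (rule finite_subset) simp
next
  case (Suc n)
  then show ?case by (rule finite_card_open_states_Suc)
qed

text \<open>Both families have the same initial states and the same recurrence. The height must vary
  in the induction because the recurrence refers to neighbouring heights.\<close>

lemma card_open_states_nest_irrelevant:
  "card (open_states True n h) = card (open_states False n h)"
proof (induction n arbitrary: h)
  case 0
  have "open_states True 0 h = open_states False 0 h"
    by (simp add: open_states_def labels_def)
  then show ?case by simp
next
  case (Suc n)
  then show ?case
    by (simp add: finite_card_open_states_Suc(2)[OF finite_open_states] split: nat.split)
qed

section \<open>Partitions as labellings\<close>

definition conflict_free :: "bool \<Rightarrow> nat set set \<Rightarrow> bool" where
  "conflict_free nest P \<longleftrightarrow>
     (\<forall>A\<in>P. \<forall>B\<in>P. \<not> conflict nest (Min A) (Min B) (Max A) (Max B))"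

definition fibres :: "nat \<Rightarrow> (nat \<Rightarrow> nat) \<Rightarrow> nat set set" where
  "fibres n f = (\<lambda>a. {i. f i = a}) ` labels n f"

lemma fibre_in_range:
  assumes "block_labelling n f" "a \<in> labels n f" "f i = a"
  shows "i \<in> {1..n}"
proof (rule ccontr)
  assume "i \<notin> {1..n}"
  then have "f i = 0" by (rule block_labelling_outside[OF assms(1)])
  then show False using assms(2,3) by (simp add: labels_def)
qed

lemma Min_fibre:
  assumes "block_labelling n f" "a \<in> labels n f"
  shows "Min {i. f i = a} = a"
proof (rule Min_eqI)
  show "finite {i. f i = a}"
    using block_labelling_fibre(1)[OF assms] .
  show "a \<in> {i. f i = a}"
    using assms by (simp add: labels_def)
  fix i assume i: "i \<in> {i. f i = a}"
  then have "i \<in> {1..n}"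
    using fibre_in_range[OF assms] by blast
  then show "a \<le> i"
    using i assms by (auto simp: block_labelling_def)
qed

lemma block_labelling_in_labels:
  "block_labelling n f \<Longrightarrow> i \<in> {1..n} \<Longrightarrow> f i \<in> labels n f"
  using block_labelling_le[of n f i] unfolding block_labelling_def labels_def by simp

text \<open>The label of an element is the minimum of its fibre, so it can be read off from the
  partition.\<close>

lemma fibres_eqD:
  assumes f: "block_labelling n f" and g: "block_labelling n g" and eq: "fibres n f = fibres n g"
  shows "f = g"
proof
  fix i
  show "f i = g i"
  proof (cases "i \<in> {1..n}")
    case True
    have "{j. f j = f i} \<in> fibres n g"
      using block_labelling_in_labels[OF f True] eq by (auto simp: fibres_def)
    then obtain b where b: "b \<in> labels n g" "{j. f j = f i} = {j. g j = b}"
      by (auto simp: fibres_def)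
    have "i \<in> {j. g j = b}"
      unfolding b(2)[symmetric] by simp
    moreover have "f i = b"
      using Min_fibre[OF f block_labelling_in_labels[OF f True]] Min_fibre[OF g b(1)] b(2) by simp
    ultimately show ?thesis by simp
  next
    case False
    then show ?thesis
      using block_labelling_outside[OF f False] block_labelling_outside[OF g False] by simp
  qed
qed

lemma partition_on_fibres:
  assumes "block_labelling n f"
  shows "partition_on {1..n} (fibres n f)"
proof (rule partition_onI)
  show "\<Union> (fibres n f) = {1..n}"
  proof (intro equalityI subsetI)
    fix i assume "i \<in> \<Union> (fibres n f)"
    then show "i \<in> {1..n}"
      unfolding fibres_def using fibre_in_range[OF assms] by blast
  next
    fix i assume "i \<in> {1..n}"
    then show "i \<in> \<Union> (fibres n f)"
      unfolding fibres_def using block_labelling_in_labels[OF assms] by blast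
  qed
next
  show "{} \<notin> fibres n f"
    unfolding fibres_def labels_def by blast
qed (auto simp: fibres_def disjnt_def)

lemma partition_is_fibres:
  assumes P: "partition_on {1..n} P"
  obtains f where "block_labelling n f" "fibres n f = P"
proof -
  \<comment> \<open>Exactly one block contains \<open>i\<close>, so the union is that block, named
    without a choice operator.\<close>
  define f where "f i = (if i \<in> {1..n} then Min (\<Union>{B\<in>P. i \<in> B}) else 0)" for i
  have sub: "B \<subseteq> {1..n}" "finite B" "B \<noteq> {}" if "B \<in> P" for B
  proof -
    show "B \<subseteq> {1..n}" "B \<noteq> {}" using P that by (auto simp: partition_on_def)
    then show "finite B" using finite_subset by blast
  qed
  have Min: "Min B \<in> B" if "B \<in> P" for B
    using sub[OF that] by simp
  have f_eq: "f i = Min B" if "B \<in> P" "i \<in> B" for i B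
  proof -
    have "A = B" if "A \<in> P" "i \<in> A" for A
      using disjointD[OF partition_onD2[OF P], of A B] that \<open>B \<in> P\<close> \<open>i \<in> B\<close> by blast
    then have "{B\<in>P. i \<in> B} = {B}"
      using that by blast
    moreover have "i \<in> {1..n}"
      using sub(1)[OF that(1)] that(2) by blast
    ultimately show ?thesis by (simp only: f_def if_True ccpo_Sup_singleton)
  qed
  have ex: "\<exists>B\<in>P. i \<in> B" if "i \<in> {1..n}" for i
    using that partition_onD1[OF P] by auto
  have bl: "block_labelling n f"
    unfolding block_labelling_def
  proof (intro conjI allI impI ballI)
    fix i assume "i \<notin> {1..n}" then show "f i = 0" by (simp only: f_def if_False)
  next
    fix i assume i: "i \<in> {1..n}"
    obtain B where B: "B \<in> P" "i \<in> B" using ex[OF i] by blast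
    show "f i \<in> {1..i}"
      using f_eq[OF B] sub[OF B(1)] Min[OF B(1)] B(2) by (auto intro: Min_le)
    show "f (f i) = f i"
      using f_eq[OF B] f_eq[OF B(1) Min[OF B(1)]] by simp
  qed
  have fibre: "{i. f i = Min B} = B" if B: "B \<in> P" for B
  proof (intro equalityI subsetI)
    fix i assume "i \<in> {i. f i = Min B}"
    then have fi: "f i = Min B" by simp
    \<comment> \<open>The default value 0 is never a block minimum, which keeps elements outside
      \<open>{1..n}\<close> out of the fibre.\<close>
    have "Min B \<noteq> 0" using Min[OF B] sub(1)[OF B] by auto
    then have "i \<in> {1..n}" using fi by (auto simp: f_def split: if_splits)
    then obtain A where A: "A \<in> P" "i \<in> A" using ex by blast
    then have "Min A = Min B" using f_eq[OF A] fi by simp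
    then have "A = B"
      using disjointD[OF partition_onD2[OF P] A(1) B] Min[OF A(1)] Min[OF B] by auto
    then show "i \<in> B" using A by simp
  qed (use f_eq B in auto)
  have "labels n f = Min ` P"
  proof (intro equalityI subsetI)
    fix a assume "a \<in> labels n f"
    then have a: "a \<in> {1..n}" "f a = a" by (auto simp: labels_def)
    then obtain B where "B \<in> P" "a \<in> B" using ex by blast
    then show "a \<in> Min ` P" using f_eq a by force
  next
    fix a assume "a \<in> Min ` P"
    then obtain B where B: "B \<in> P" "a = Min B" by blast
    then have "a \<in> B" using Min by blast
    then show "a \<in> labels n f"
      using f_eq[OF B(1)] sub(1)[OF B(1)] B(2) by (auto simp: labels_def)
  qed
  then have "fibres n f = P"
    using fibre by (auto simp: fibres_def image_image)
  with bl that show thesis by blast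
qed

text \<open>With no open blocks, \<open>block_end\<close> is the true maximum of a fibre, and by
  \<open>Min_fibre\<close> its label is the minimum; the two conflict conditions then
  coincide.\<close>

lemma conflict_free_fibres:
  assumes f: "block_labelling n f"
  shows "(f, {}) \<in> open_states nest n 0 \<longleftrightarrow> conflict_free nest (fibres n f)"
  using f Min_fibre[OF f] by (simp add: open_states_def conflict_free_def fibres_def block_end_def)

lemma card_conflict_free_partitions:
  "card {P. partition_on {1..n} P \<and> conflict_free nest P} = card (open_states nest n 0)"
proof -
  have empty: "block_labelling n f \<and> U = {}" if "(f, U) \<in> open_states nest n 0" for f U
    using that finite_open_labels[of n f U] by (auto simp: open_states_def)
  have "bij_betw (\<lambda>(f, U). fibres n f) (open_states nest n 0)
          {P. partition_on {1..n} P \<and> conflict_free nest P}"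
  proof (rule bij_betw_imageI)
    show "inj_on (\<lambda>(f, U). fibres n f) (open_states nest n 0)"
    proof (intro inj_onI, clarify, intro conjI)
      fix f U g V
      assume *: "(f, U) \<in> open_states nest n 0" "(g, V) \<in> open_states nest n 0" "fibres n f = fibres n g"
      show "f = g" using fibres_eqD[OF _ _ *(3)] empty *(1,2) by blast
      show "U = V" using empty *(1,2) by blast
    qed
    show "(\<lambda>(f, U). fibres n f) ` open_states nest n 0 = {P. partition_on {1..n} P \<and> conflict_free nest P}"
    proof (intro equalityI subsetI)
      fix P assume "P \<in> (\<lambda>(f, U). fibres n f) ` open_states nest n 0"
      then obtain f U where fU: "(f, U) \<in> open_states nest n 0" "P = fibres n f" by auto
      then have "block_labelling n f" "(f, {}) \<in> open_states nest n 0"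
        using empty by blast+
      then show "P \<in> {P. partition_on {1..n} P \<and> conflict_free nest P}"
        using partition_on_fibres conflict_free_fibres fU(2) by blast
    next
      fix P assume P: "P \<in> {P. partition_on {1..n} P \<and> conflict_free nest P}"
      then obtain f where f: "block_labelling n f" "fibres n f = P"
        using partition_is_fibres by blast
      then have "(f, {}) \<in> open_states nest n 0"
        using conflict_free_fibres P by blast
      then show "P \<in> (\<lambda>(f, U). fibres n f) ` open_states nest n 0"
        by (rule rev_image_eqI) (simp add: f(2))
    qed
  qed
  then show ?thesis by (rule bij_betw_same_card[THEN sym])
qed

lemma bessel_number_eq:
  "bessel_number n = card {P. partition_on {1..n} P \<and> conflict_free True P}"
proof -
  have "conflict False a b x y \<longleftrightarrow> a < b \<and> b < x \<and> x < y" for a b x y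
    by (simp add: conflict_def)
  then have "non_overlapping P \<longleftrightarrow> conflict_free False P" for P
    unfolding non_overlapping_def conflict_free_def by simp
  then have "bessel_number n = card {P. partition_on {1..n} P \<and> conflict_free False P}"
    unfolding bessel_number_def by presburger
  also have "\<dots> = card (open_states True n 0)"
    unfolding card_conflict_free_partitions by (rule card_open_states_nest_irrelevant[symmetric])
  also have "\<dots> = card {P. partition_on {1..n} P \<and> conflict_free True P}"
    by (rule card_conflict_free_partitions[symmetric])
  finally show ?thesis .
qed

section \<open>Cycles of the hat permutation\<close>

text \<open>A description of the cycle factors without positions: cutting before each left-to-right
  maximum yields blocks headed by their maxima, with increasing heads, and by
  \<open>ltr_cycles_concat\<close> no other factorisation has this form.\<close>

definition cycle_decomposition :: "nat list list \<Rightarrow> bool" where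
  "cycle_decomposition bs \<longleftrightarrow>
     (\<forall>b\<in>set bs. b \<noteq> [] \<and> (\<forall>x\<in>set (tl b). x < hd b)) \<and> sorted_wrt (\<lambda>b c. hd b < hd c) bs"

lemma cycle_decomposition_snoc:
  "cycle_decomposition (bs @ [b]) \<longleftrightarrow>
     cycle_decomposition bs \<and> b \<noteq> [] \<and> (\<forall>x\<in>set (tl b). x < hd b) \<and> (\<forall>c\<in>set bs. hd c < hd b)"
  by (auto simp: cycle_decomposition_def sorted_wrt_append)

lemma le_hd_block:
  assumes "cycle_decomposition bs" "b \<in> set bs" "x \<in> set b"
  shows "x \<le> hd b"
  using assms by (cases b) (force simp: cycle_decomposition_def)+

text \<open>Being a left-to-right maximum depends only on the entries to the left, so the positions
  in \<open>w\<close> are unaffected. The head of \<open>b\<close> beats all of \<open>w\<close>,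
  and the rest of \<open>b\<close> stays below that head.\<close>

lemma ltr_max_positions_append_block:
  assumes b: "b \<noteq> []" "\<forall>x\<in>set (tl b). x < hd b" and w: "\<forall>x\<in>set w. x < hd b"
  shows "ltr_max_positions (w @ b) = ltr_max_positions w @ [length w]"
proof -
  obtain m c where bm: "b = m # c" using b by (cases b) auto
  have "ltr_max (w @ b) i \<longleftrightarrow> ltr_max w i" if "i < length w" for i
    using that by (auto simp: ltr_max_def nth_append)
  then have "filter (ltr_max (w @ b)) [0..<length w] = ltr_max_positions w"
    unfolding ltr_max_positions_def by (intro filter_cong) auto
  moreover have "ltr_max (w @ b) (length w)"
    using w bm by (auto simp: ltr_max_def nth_append)
  moreover have "\<not> ltr_max (w @ b) i" if "length w < i" "i < length (w @ b)" for i
  proof -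
    have "(w @ b) ! i = c ! (i - length w - 1)" "i - length w - 1 < length c"
      using that bm by (auto simp: nth_append nth_Cons')
    then have "(w @ b) ! i < m"
      using b(2) bm by (metis list.sel(1,3) nth_mem)
    moreover have "(w @ b) ! length w = m" by (simp add: bm)
    ultimately show ?thesis
      using that by (auto simp: ltr_max_def not_less intro!: exI[of _ "length w"])
  qed
  then have "filter (ltr_max (w @ b)) [Suc (length w)..<length (w @ b)] = []"
    by (intro filter_False) auto
  moreover have "[0..<length (w @ b)] = [0..<length w] @ length w # [Suc (length w)..<length (w @ b)]"
    using bm by (metis length_append less_add_same_cancel1 length_greater_0_conv b(1) upt_add_eq_append
        upt_conv_Cons zero_le less_imp_le_nat le_add1 add_0)
  ultimately show ?thesis
    by (simp add: ltr_max_positions_def)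
qed

lemma ltr_cycles_append_block:
  assumes b: "b \<noteq> []" "\<forall>x\<in>set (tl b). x < hd b" and w: "\<forall>x\<in>set w. x < hd b"
  shows "ltr_cycles (w @ b) = ltr_cycles w @ [b]"
proof -
  let ?ps = "ltr_max_positions w" and ?qs = "tl (ltr_max_positions w) @ [length w]"
  show ?thesis
  \<comment> \<open>For an empty list of positions, \<open>?ps\<close> and \<open>?qs\<close> differ
    in length, so the zip cannot be split as in the other case.\<close>
  proof (cases "?ps = []")
    case True
    have "w = []"
    proof (rule ccontr)
      assume "w \<noteq> []"
      then have "ltr_max w 0" "0 \<in> set [0..<length w]" by (auto simp: ltr_max_def)
      then have "0 \<in> set ?ps" unfolding ltr_max_positions_def by simp
      then show False using True by simp
    qed
    then show ?thesis
      using ltr_max_positions_append_block[OF assms] True by (simp add: ltr_cycles_def)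
  next
    case False
    \<comment> \<open>All old factors end within \<open>w\<close>, so appending \<open>b\<close>
      does not change them.\<close>
    have bound: "q \<le> length w" if "q \<in> set ?qs" for q
    proof -
      have "q \<in> set ?ps \<or> q = length w" using that by (auto dest: list.set_sel(2)[OF False])
      then show ?thesis by (auto simp: ltr_max_positions_def)
    qed
    have len: "length ?ps = length ?qs" using False by simp
    \<comment> \<open>The old final endpoint \<open>length w\<close> becomes the start of the new
      last factor.\<close>
    have "ltr_cycles (w @ b) = map2 (\<lambda>i j. take (j - i) (drop i (w @ b))) (?ps @ [length w]) (?qs @ [length (w @ b)])"
      using False by (simp add: ltr_cycles_def ltr_max_positions_append_block[OF assms])
    also have "\<dots> = map2 (\<lambda>i j. take (j - i) (drop i (w @ b))) ?ps ?qs @ [b]"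
      by (subst zip_append[OF len]) simp
    also have "map2 (\<lambda>i j. take (j - i) (drop i (w @ b))) ?ps ?qs = map2 (\<lambda>i j. take (j - i) (drop i w)) ?ps ?qs"
      by (intro map_cong refl) (auto dest!: set_zip_rightD bound simp: le_diff_conv)
    finally show ?thesis by (simp add: ltr_cycles_def Let_def)
  qed
qed

lemma ltr_cycles_concat:
  "cycle_decomposition bs \<Longrightarrow> ltr_cycles (concat bs) = bs"
proof (induction bs rule: rev_induct)
  case Nil
  then show ?case by (simp add: ltr_cycles_def ltr_max_positions_def)
next
  case (snoc b bs)
  then have bs: "cycle_decomposition bs" and b: "b \<noteq> []" "\<forall>x\<in>set (tl b). x < hd b"
    and less: "\<forall>c\<in>set bs. hd c < hd b"
    by (auto simp: cycle_decomposition_snoc)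
  have "\<forall>x\<in>set (concat bs). x < hd b"
    using le_hd_block[OF bs] less by fastforce
  from ltr_cycles_append_block[OF b this] snoc.IH[OF bs] show ?case by simp
qed

text \<open>Appending a letter either starts a new block, if it exceeds all heads, or prolongs the
  last block, whose head is the largest.\<close>

lemma ex_cycle_decomposition:
  "distinct w \<Longrightarrow> \<exists>bs. cycle_decomposition bs \<and> concat bs = w"
proof (induction w rule: rev_induct)
  case Nil
  then show ?case by (auto simp: cycle_decomposition_def intro: exI[of _ "[]"])
next
  case (snoc x w)
  then obtain bs where bs: "cycle_decomposition bs" "concat bs = w" by auto
  show ?case
  proof (cases "\<forall>c\<in>set bs. hd c < x")
    case True
    then have "cycle_decomposition (bs @ [[x]])"
      using bs by (simp add: cycle_decomposition_snoc)
    then show ?thesis using bs(2) by (intro exI[of _ "bs @ [[x]]"]) simp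
  next
    case False
    then obtain cs b where bs_eq: "bs = cs @ [b]" by (cases bs rule: rev_cases) auto
    have b: "cycle_decomposition cs" "b \<noteq> []" "\<forall>x\<in>set (tl b). x < hd b" "\<forall>c\<in>set cs. hd c < hd b"
      using bs(1) unfolding bs_eq cycle_decomposition_snoc by auto
    obtain c where "c \<in> set bs" "x \<le> hd c" using False by (auto simp: not_less)
    then have "x \<le> hd b" using b(4) bs_eq by auto
    moreover have "x \<noteq> hd b"
      using snoc.prems b(2) bs(2) bs_eq by (auto dest: hd_in_set)
    ultimately have "cycle_decomposition (cs @ [b @ [x]])"
      using b by (auto simp: cycle_decomposition_snoc tl_append2)
    then show ?thesis using bs(2) bs_eq by (intro exI[of _ "cs @ [b @ [x]]"]) simp
  qed
qed

lemma foldr_cycles_outside: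
  "x \<notin> set (concat bs) \<Longrightarrow> foldr (\<circ>) (map cycle_of_list bs) id x = x"
  by (induction bs) (simp_all add: id_outside_supp)

lemma foldr_cycles_inside:
  assumes "distinct (concat bs)" "b \<in> set bs" "x \<in> set b"
  shows "foldr (\<circ>) (map cycle_of_list bs) id x = cycle_of_list b x"
  using assms
proof (induction bs)
  case (Cons c cs)
  have disj: "set c \<inter> set (concat cs) = {}" "distinct (concat cs)"
    using Cons.prems(1) by auto
  show ?case
  proof (cases "b \<in> set cs")
    case True
    \<comment> \<open>The image stays in \<open>b\<close>, so the cycle \<open>c\<close>, applied
      afterwards and disjoint from \<open>b\<close>, fixes it.\<close>
    have "cycle_of_list b x \<in> set b"
      using Cons.prems(3) by (simp add: permutes_in_image[OF cycle_permutes])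
    then have "cycle_of_list b x \<notin> set c"
      using True disj(1) by auto
    then show ?thesis
      using Cons.IH[OF disj(2) True Cons.prems(3)] by (simp add: id_outside_supp)
  next
    case False
    then have "b = c" using Cons.prems(2) by simp
    then have "x \<notin> set (concat cs)" using Cons.prems(3) disj(1) by blast
    moreover have "foldr (\<circ>) (map cycle_of_list (c # cs)) id =
        cycle_of_list c \<circ> foldr (\<circ>) (map cycle_of_list cs) id" by simp
    ultimately show ?thesis
      using foldr_cycles_outside[of x cs] \<open>b = c\<close> by (metis comp_apply)
  qed
qed simp

lemma hat_block:
  assumes "distinct (concat bs)" "cycle_decomposition bs" "b \<in> set bs" "x \<in> set b"
  shows "hat (concat bs) x = cycle_of_list b x"
  using assms by (simp add: hat_def ltr_cycles_concat foldr_cycles_inside)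

lemma cycle_of_list_nth:
  assumes "distinct b" "i < length b"
  shows "cycle_of_list b (b ! i) = b ! (Suc i mod length b)"
proof -
  have "map (cycle_of_list b) b = rotate1 b"
    using cyclic_rotation[OF assms(1), of 1] by simp
  then have "cycle_of_list b (b ! i) = rotate1 b ! i"
    using assms(2) by (metis nth_map)
  then show ?thesis using assms(2) by (simp add: nth_rotate1)
qed

section \<open>Pattern containment in terms of blocks\<close>

text \<open>Stated by a splitting of the word, since concatenations of blocks supply splittings;
  \<open>precedes_iff_nth\<close> translates to the indices used by arrow patterns.\<close>

definition precedes :: "nat list \<Rightarrow> nat \<Rightarrow> nat \<Rightarrow> bool" where
  "precedes w c a \<longleftrightarrow> (\<exists>xs ys. w = xs @ ys \<and> c \<in> set xs \<and> a \<in> set ys)"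

lemma precedes_iff_nth:
  "precedes w c a \<longleftrightarrow> (\<exists>p q. p < q \<and> q < length w \<and> w ! p = c \<and> w ! q = a)"
proof
  assume "precedes w c a"
  then obtain xs ys where w: "w = xs @ ys" "c \<in> set xs" "a \<in> set ys"
    by (auto simp: precedes_def)
  then obtain p q where "p < length xs" "xs ! p = c" "q < length ys" "ys ! q = a"
    by (auto simp: in_set_conv_nth)
  then show "\<exists>p q. p < q \<and> q < length w \<and> w ! p = c \<and> w ! q = a"
    using w(1) by (intro exI[of _ p] exI[of _ "length xs + q"]) (auto simp: nth_append)
next
  assume "\<exists>p q. p < q \<and> q < length w \<and> w ! p = c \<and> w ! q = a"
  then obtain p q where pq: "p < q" "q < length w" "w ! p = c" "w ! q = a" by blast
  have "c \<in> set (take q w)"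
    using pq by (auto simp: in_set_conv_nth intro!: exI[of _ p])
  moreover have "a \<in> set (drop q w)"
    using pq by (auto simp: in_set_conv_nth intro!: exI[of _ 0])
  ultimately show "precedes w c a"
    unfolding precedes_def by (metis append_take_drop_id)
qed

lemma precedes_asym: "distinct w \<Longrightarrow> precedes w c a \<Longrightarrow> \<not> precedes w a c"
  unfolding precedes_iff_nth by (metis less_asym less_trans nth_eq_iff_index_eq)

lemma precedes_in_block:
  assumes "b \<in> set bs" "precedes b c a"
  shows "precedes (concat bs) c a"
proof -
  obtain us vs where "bs = us @ b # vs" using assms(1) by (auto simp: in_set_conv_decomp)
  moreover obtain xs ys where "b = xs @ ys" "c \<in> set xs" "a \<in> set ys"
    using assms(2) by (auto simp: precedes_def)
  ultimately show ?thesis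
    unfolding precedes_def
    by (intro exI[of _ "concat us @ xs"] exI[of _ "ys @ concat vs"]) simp
qed

lemma precedes_across_blocks:
  assumes bs: "cycle_decomposition bs" and AB: "A \<in> set bs" "B \<in> set bs" "hd A < hd B"
    and "x \<in> set A" "y \<in> set B"
  shows "precedes (concat bs) x y"
proof -
  obtain us vs where bs_eq: "bs = us @ B # vs" using AB(2) by (auto simp: in_set_conv_decomp)
  have "A \<notin> set (B # vs)"
    using bs AB(3) unfolding bs_eq cycle_decomposition_def by (auto simp: sorted_wrt_append)
  then have "A \<in> set us" using AB(1) bs_eq by auto
  then show ?thesis
    using assms(5,6) bs_eq unfolding precedes_def
    by (intro exI[of _ "concat us"] exI[of _ "concat (B # vs)"]) auto
qed

lemma contains_arrow_iff:
  assumes w: "set w = {1..length w}"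
  shows "contains_arrow w ([3, 1], {(2, 3)}) \<longleftrightarrow>
     (\<exists>a b c. a < b \<and> b < c \<and> {a, b, c} \<subseteq> {1..length w} \<and> precedes w c a \<and> hat w b = c)"
    (is "?L \<longleftrightarrow> ?R")
proof
  assume ?L
  then obtain x t :: "nat \<Rightarrow> nat" where
    x: "strict_mono_on {1..3} x" "x ` {1..3} \<subseteq> {1..length w}" and
    t: "strict_mono_on {..<2} t" "t ` {..<2} \<subseteq> {..<length w}" and
    h: "\<forall>i<2. w ! t i = x ([3, 1] ! i)" "hat w (x 2) = x 3"
    unfolding contains_arrow_def is_arrow_pattern_31_2_3(2) by (auto simp: numeral_2_eq_2)
  have "x 1 < x 2" "x 2 < x 3"
    by (intro strict_mono_onD[OF x(1)]; simp)+
  moreover have "t 0 < t 1"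
    by (intro strict_mono_onD[OF t(1)]; simp)
  moreover have "{x 1, x 2, x 3} \<subseteq> {1..length w}"
    by (rule order_trans[OF _ x(2)]) auto
  moreover have "t 1 < length w"
    using t(2) by (auto simp: image_subset_iff)
  moreover have "w ! t 0 = x 3" "w ! t 1 = x 1"
    using h(1)[rule_format, of 0] h(1)[rule_format, of 1] by auto
  ultimately show ?R
    using h(2) unfolding precedes_iff_nth by blast
next
  assume ?R
  then obtain a b c p q where abc: "a < b" "b < c" "{a, b, c} \<subseteq> {1..length w}" "hat w b = c"
    and pq: "p < q" "q < length w" "w ! p = c" "w ! q = a"
    unfolding precedes_iff_nth by blast
  \<comment> \<open>The letters 1, 2, 3 of the pattern become \<open>a\<close>, \<open>b\<close>,
    \<open>c\<close>; the word 31 asks for \<open>c\<close> at position \<open>p\<close> and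
    \<open>a\<close> at the later position \<open>q\<close>.\<close>
  define x where "x i = (if i = 1 then a else if i = 2 then b else c)" for i :: nat
  define t where "t i = (if i = 0 then p else q)" for i :: nat
  have "strict_mono_on {1..3} x" "strict_mono_on {..<2} t"
    using abc pq unfolding strict_mono_on_def x_def t_def by auto
  moreover have "x ` {1..3} \<subseteq> {1..length w}" "t ` {..<2} \<subseteq> {..<length w}"
    using abc pq unfolding x_def t_def by auto
  moreover have "w ! t i = x ([3, 1] ! i)" if "i < 2" for i
    using pq that unfolding x_def t_def by (auto simp: less_2_cases_iff)
  moreover have "hat w (x 2) = x 3"
    using abc by (simp add: x_def)
  ultimately show ?L
    unfolding contains_arrow_def is_arrow_pattern_31_2_3(2) prod.case
    by (intro exI[of _ x] exI[of _ t]) (simp add: numeral_2_eq_2)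
qed

lemma contains_arrow_concat_iff:
  assumes bs: "cycle_decomposition bs" and w: "distinct (concat bs)" "set (concat bs) = {1..n}"
  shows "contains_arrow (concat bs) ([3, 1], {(2, 3)}) \<longleftrightarrow>
    \<not> ((\<forall>B\<in>set bs. sorted_wrt (>) B) \<and> conflict_free True (set ` set bs))"
proof -
  let ?w = "concat bs"
  have len: "length ?w = n"
    using distinct_card[OF w(1)] w(2) by simp
  have contains: "contains_arrow ?w ([3, 1], {(2, 3)}) \<longleftrightarrow>
      (\<exists>a b c. a < b \<and> b < c \<and> {a, b, c} \<subseteq> {1..n} \<and> precedes ?w c a \<and> hat ?w b = c)"
    using contains_arrow_iff[of ?w] w(2) len by simp
  have distB: "distinct B" "B \<noteq> []" if "B \<in> set bs" for B
    using w(1) that bs by (auto simp: distinct_concat_iff cycle_decomposition_def)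
  have in_range: "x \<in> {1..n}" if "x \<in> set B" "B \<in> set bs" for x B
    using w(2) that by auto
  have sorted_Max: "Max (set B) = hd B" "Min (set B) = last B"
    if "B \<in> set bs" and sorted: "sorted_wrt (>) B" for B
  proof -
    show "Max (set B) = hd B"
      using le_hd_block[OF bs that(1)] distB(2)[OF that(1)] by (intro Max_eqI) auto
    have "last B \<le> x" if x: "x \<in> set B" for x
      using sorted x by (induction B) (auto intro: less_imp_le)
    then show "Min (set B) = last B"
      using distB(2)[OF that(1)] by (intro Min_eqI) auto
  qed
  show ?thesis
  proof (cases "contains_arrow ?w ([3, 1], {(2, 3)})")
    case True
    then obtain a b c where abc: "a < b" "b < c" "{a, b, c} \<subseteq> {1..n}" "precedes ?w c a" "hat ?w b = c"
      unfolding contains by blast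
    have "\<not> conflict_free True (set ` set bs)" if sorted: "\<forall>B\<in>set bs. sorted_wrt (>) B"
    proof
      assume cf: "conflict_free True (set ` set bs)"
      have "a \<in> set ?w" "b \<in> set ?w" using abc(3) w(2) by auto
      then obtain A B where A: "A \<in> set bs" "a \<in> set A" and B: "B \<in> set bs" "b \<in> set B"
        by auto
      then obtain i where i: "i < length B" "B ! i = b" by (auto simp: in_set_conv_nth)
      have c: "c = B ! (Suc i mod length B)"
        using hat_block[OF w(1) bs B] cycle_of_list_nth[OF distB(1)[OF B(1)] i(1)] i(2) abc(5) by simp
      \<comment> \<open>In a decreasing block only the last entry can be sent upwards, so
        \<open>b\<close> ends its block and \<open>c\<close> heads it.\<close>
      have "\<not> Suc i < length B"
      proof
        assume *: "Suc i < length B"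
        then have "c = B ! Suc i" using c by simp
        moreover have "B ! i > B ! Suc i"
          using sorted B(1) * by (auto simp: sorted_wrt_iff_nth_less)
        ultimately show False using i(2) abc(2) by simp
      qed
      then have "i = length B - 1" "Suc i mod length B = 0" using i(1) by (auto simp: mod_Suc)
      then have b_last: "b = last B" and c_hd: "c = hd B"
        using i c distB(2)[OF B(1)] by (auto simp: last_conv_nth hd_conv_nth)
      have minA: "Min (set A) \<le> a" using A(2) by simp
      have minB: "Min (set B) = b" "Max (set B) = c"
        using sorted_Max[OF B(1)] sorted B(1) b_last c_hd by auto
      \<comment> \<open>The minimum of \<open>A\<close> is at most \<open>a\<close>, hence below
        \<open>b\<close>, the minimum of \<open>B\<close>; since \<open>B\<close> is not nested in
        \<open>A\<close>, its maximum is not the smaller one. So \<open>A\<close> comes before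
        \<open>B\<close>, and \<open>a\<close> before \<open>c\<close>.\<close>
      have "\<not> Max (set B) < Max (set A)"
        using cf A(1) B(1) minA minB abc(1,2) unfolding conflict_free_def conflict_def by fastforce
      then have "hd A \<le> hd B"
        using sorted_Max(1)[OF A(1)] sorted_Max(1)[OF B(1)] sorted A(1) B(1) by simp
      moreover have "hd A \<noteq> hd B"
      proof
        assume eq: "hd A = hd B"
        then have "A = B"
          using w(1) A(1) B(1) distB(2) by (metis IntI distinct_concat_iff empty_iff hd_in_set)
        then have "Min (set B) \<le> a" using A(2) by simp
        then show False using minB abc(1) by simp
      qed
      ultimately have "precedes ?w a c"
        using precedes_across_blocks[OF bs A(1) B(1) _ A(2)] c_hd distB(2)[OF B(1)] by simp
      then show False using precedes_asym[OF w(1)] abc(4) by blast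
    qed
    then show ?thesis using True by blast
  next
    case False
    then have avoid: "\<not> precedes ?w (hat ?w b) a"
      if "a < b" "b < hat ?w b" "a \<in> {1..n}" "b \<in> {1..n}" "hat ?w b \<in> {1..n}" for a b
      using that unfolding contains by blast
    \<comment> \<open>An entry \<open>x\<close> below the last entry would give the occurrence
      \<open>x\<close>, \<open>last B\<close>, \<open>hd B\<close>, because \<open>hat\<close> sends
      \<open>last B\<close> to \<open>hd B\<close> and \<open>hd B\<close> precedes
      \<open>x\<close>.\<close>
    have last_le: "last B \<le> x" if B: "B \<in> set bs" "x \<in> set B" for B x
    proof (rule ccontr)
      assume x: "\<not> last B \<le> x"
      have B': "distinct B" "B \<noteq> []" using distB[OF B(1)] by auto
      have hat: "hat ?w (last B) = hd B"
        using hat_block[OF w(1) bs B(1)] cycle_of_list_nth[OF B'(1), of "length B - 1"] B'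
        by (simp add: last_conv_nth hd_conv_nth)
      have "last B \<le> hd B" using le_hd_block[OF bs B(1)] B'(2) by simp
      moreover have "last B \<noteq> hd B"
      proof
        assume "last B = hd B"
        moreover obtain m c where B_eq: "B = m # c" using B'(2) by (cases B) auto
        ultimately have "c = []"
          using B'(1) last_in_set[of c] by (auto split: if_splits)
        then show False using x B(2) B_eq by simp
      qed
      ultimately have "last B < hd B" by simp
      moreover have "precedes B (hd B) x"
      proof -
        have "x \<noteq> hd B" using x \<open>last B < hd B\<close> by simp
        then have "x \<in> set (tl B)" using B(2) B'(2) by (cases B) auto
        then show ?thesis
          using B'(2) unfolding precedes_def by (intro exI[of _ "[hd B]"] exI[of _ "tl B"]) simp
      qed
      ultimately show False
        using avoid[of x "last B"] x hat B'(2) in_range[OF _ B(1)] B(2) precedes_in_block[OF B(1)] by simp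
    qed
    have sorted: "sorted_wrt (>) B" if B: "B \<in> set bs" for B
    proof -
      have B': "distinct B" "B \<noteq> []" using distB[OF B] by auto
      \<comment> \<open>An ascent would give the occurrence \<open>last B\<close>,
        \<open>B ! i\<close>, \<open>B ! Suc i\<close>. The top of the ascent is not the last entry,
        since that is the minimum of the block.\<close>
      have "B ! Suc i < B ! i" if i: "Suc i < length B" for i
      proof (rule ccontr)
        assume "\<not> B ! Suc i < B ! i"
        moreover have "B ! Suc i \<noteq> B ! i" using B'(1) i by (simp add: nth_eq_iff_index_eq)
        ultimately have asc: "B ! i < B ! Suc i" by simp
        have hat: "hat ?w (B ! i) = B ! Suc i"
          using hat_block[OF w(1) bs B] cycle_of_list_nth[OF B'(1), of i] i by simp
        have "last B \<noteq> B ! i"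
          using B' i by (simp add: last_conv_nth nth_eq_iff_index_eq)
        then have less: "last B < B ! i" using last_le[OF B, of "B ! i"] i by simp
        have "length B - 1 \<noteq> Suc i"
        proof
          assume "length B - 1 = Suc i"
          then have "last B = B ! Suc i" using B'(2) by (simp add: last_conv_nth)
          then show False using less asc by simp
        qed
        then have "precedes B (B ! Suc i) (last B)"
          using i B'(2) unfolding precedes_iff_nth last_conv_nth[OF B'(2)]
          by (intro exI[of _ "Suc i"] exI[of _ "length B - 1"]) auto
        then show False
          using avoid[of "last B" "B ! i"] less asc hat i B'(2) in_range[OF _ B] precedes_in_block[OF B] by simp
      qed
      then show ?thesis
        by (subst sorted_wrt_iff_nth_Suc_transp) (auto intro: transpI)
    qed
    moreover have "conflict_free True (set ` set bs)"
      unfolding conflict_free_def conflict_def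
    proof (intro ballI notI, elim imageE)
      fix A' B' A B
      assume conf: "Min A' < Min B' \<and> (if True then Min B' < Max B' \<and> Max B' < Max A' else Min B' < Max A' \<and> Max A' < Max B')"
        and A: "A' = set A" "A \<in> set bs" and B: "B' = set B" "B \<in> set bs"
      \<comment> \<open>If \<open>B\<close> is nested in \<open>A\<close>, its smaller head puts it
        earlier in the word, and \<open>last A\<close>, \<open>last B\<close>, \<open>hd B\<close>
        form an occurrence.\<close>
      have *: "last A < last B" "last B < hd B" "hd B < hd A"
        using conf sorted_Max[OF A(2) sorted[OF A(2)]] sorted_Max[OF B(2) sorted[OF B(2)]] A(1) B(1) by auto
      have ne: "A \<noteq> []" "B \<noteq> []" using A(2) B(2) distB by auto
      have hat: "hat ?w (last B) = hd B"
        using hat_block[OF w(1) bs B(2)] cycle_of_list_nth[OF distB(1)[OF B(2)], of "length B - 1"] ne(2)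
        by (simp add: last_conv_nth hd_conv_nth)
      have "precedes ?w (hd B) (last A)"
        using precedes_across_blocks[OF bs B(2) A(2) *(3)] ne by simp
      then show False
        using avoid[of "last A" "last B"] * hat ne in_range[OF _ A(2)] in_range[OF _ B(2)] by simp
    qed
    ultimately show ?thesis using False by blast
  qed
qed

section \<open>The bijection between avoiders and non-nesting partitions\<close>

lemma partition_on_blocks:
  assumes "distinct (concat bs)" "set (concat bs) = {1..n}" "\<forall>b\<in>set bs. b \<noteq> []"
  shows "partition_on {1..n} (set ` set bs)"
proof (rule partition_onI)
  fix p q assume "p \<in> set ` set bs" "q \<in> set ` set bs" "p \<noteq> q"
  then show "disjnt p q"
    using assms(1) by (auto simp: distinct_concat_iff disjnt_def)
qed (use assms in auto)

text \<open>A decreasing list is determined by its set of entries, and the order of the blocks by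
  their increasing heads.\<close>

lemma sorted_blocks_unique:
  assumes "cycle_decomposition bs" "cycle_decomposition cs"
    and "\<forall>b\<in>set bs. sorted_wrt (>) b" "\<forall>c\<in>set cs. sorted_wrt (>) c"
    and eq: "set ` set bs = set ` set cs"
  shows "bs = cs"
proof -
  have uniq: "b = c" if "sorted_wrt (>) b" "sorted_wrt (>) c" "set b = set c" for b c :: "nat list"
  proof -
    have "sorted_wrt (<) (rev b)" "sorted_wrt (<) (rev c)"
      using that(1,2) by (simp_all add: sorted_wrt_rev)
    then have "rev b = rev c"
      using that(3) by (intro strict_sorted_equal) auto
    then show ?thesis by simp
  qed
  have "set bs = set cs"
    using uniq assms(3,4) eq by (auto simp: set_eq_iff[of "set ` _"] image_iff) metis+
  moreover have "sorted_wrt (<) (map hd bs)" "sorted_wrt (<) (map hd cs)"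
    using assms(1,2) by (simp_all add: cycle_decomposition_def sorted_wrt_map)
  ultimately have maps: "map hd bs = map hd cs"
    by (intro strict_sorted_equal) auto
  have "inj_on hd (set bs)"
    using \<open>sorted_wrt (<) (map hd bs)\<close> by (metis distinct_map strict_sorted_iff)
  then show ?thesis
    using maps \<open>set bs = set cs\<close> by (intro map_inj_on[of hd]) auto
qed

lemma ex_sorted_blocks:
  assumes P: "partition_on {1..n} P"
  obtains bs where "cycle_decomposition bs" "\<forall>b\<in>set bs. sorted_wrt (>) b" "set ` set bs = P"
    "distinct (concat bs)" "set (concat bs) = {1..n}"
proof -
  have fin: "finite P" using P by (rule finite_elements[rotated]) simp
  have B: "finite B" "B \<noteq> {}" if "B \<in> P" for B
    using P that finite_subset[of B "{1..n}"] by (auto simp: partition_on_def)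
  define r where "r B = rev (sorted_list_of_set B)" for B :: "nat set"
  \<comment> \<open>The block maxima in increasing order. Disjoint blocks have distinct maxima, so
    inverting \<open>Max\<close> on \<open>P\<close> lists the blocks in this order.\<close>
  define ks where "ks = sorted_list_of_set (Max ` P)"
  have inj: "inj_on Max P"
  proof (rule inj_onI)
    fix A B' assume AB: "A \<in> P" "B' \<in> P" "Max A = Max B'"
    then have "Max A \<in> A \<inter> B'" using Max_in[OF B[OF AB(1)]] Max_in[OF B[OF AB(2)]] by simp
    then show "A = B'" using partition_onD2[OF P] AB(1,2) by (auto simp: disjoint_def)
  qed
  have block: "the_inv_into P Max m \<in> P" "Max (the_inv_into P Max m) = m" if "m \<in> Max ` P" for m
    using that inj by (auto simp: the_inv_into_f_f)
  have r: "set (r B) = B" "sorted_wrt (>) (r B)" "r B \<noteq> []" "hd (r B) = Max B" "distinct (r B)"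
    if "B \<in> P" for B
  proof -
    show *: "set (r B) = B" "sorted_wrt (>) (r B)" "distinct (r B)"
      using B[OF that] by (simp_all add: r_def sorted_wrt_rev)
    show "r B \<noteq> []" using *(1) B[OF that] by auto
    then obtain m c where mc: "r B = m # c" by (cases "r B") auto
    have "Max (set (r B)) = m"
      using *(2) unfolding mc by (intro Max_eqI) auto
    then show "hd (r B) = Max B" using mc *(1) by simp
  qed
  define bs where "bs = map (\<lambda>m. r (the_inv_into P Max m)) ks"
  have ks: "set ks = Max ` P" "sorted_wrt (<) ks" using fin by (auto simp: ks_def)
  have set_bs: "set bs = r ` P"
    using block inj by (auto simp: bs_def ks(1) image_image the_inv_into_f_f)
  have "sorted_wrt (\<lambda>b c. hd b < hd c) bs"
    unfolding bs_def sorted_wrt_map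
    by (rule sorted_wrt_mono_rel[OF _ ks(2)]) (use r(4) block ks(1) in auto)
  moreover have "\<forall>x\<in>set (tl (r B)). x < hd (r B)" if "B \<in> P" for B
    using r(2)[OF that] r(3)[OF that] by (cases "r B") auto
  ultimately have dec: "cycle_decomposition bs"
    using r(3) by (auto simp: cycle_decomposition_def set_bs)
  have sets: "set ` set bs = P"
    using r(1) by (auto simp: set_bs image_image)
  have "sorted_wrt (<) (map hd bs)"
    using dec by (simp add: cycle_decomposition_def sorted_wrt_map)
  then have "distinct bs"
    by (metis distinct_map strict_sorted_iff)
  moreover have "set b \<inter> set c = {}" if bc: "b \<in> set bs" "c \<in> set bs" "b \<noteq> c" for b c
  proof -
    obtain A C where "A \<in> P" "C \<in> P" "b = r A" "c = r C" using bc set_bs by auto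
    then show ?thesis
      using bc(3) r(1) disjointD[OF partition_onD2[OF P], of A C] by auto
  qed
  ultimately have "distinct (concat bs)"
    using r(3,5) by (auto simp: distinct_concat_iff set_bs distinct_removeAll)
  moreover have "set (concat bs) = {1..n}"
    using sets partition_onD1[OF P] by auto
  ultimately show thesis
    using that[OF dec _ sets] r(2) set_bs by auto
qed

lemma ltr_cycles_decomposition:
  assumes "distinct w"
  shows "cycle_decomposition (ltr_cycles w)" "concat (ltr_cycles w) = w"
  using ex_cycle_decomposition[OF assms] ltr_cycles_concat by auto

text \<open>The inverse map writes each block decreasingly, lists the blocks by increasing maximum
  and concatenates them; by \<open>contains_arrow_concat_iff\<close> the resulting word avoids the
  pattern.\<close>

lemma bij_betw_avoiders_partitions:
  "bij_betw (\<lambda>w. set ` set (ltr_cycles w)) (arrow_avoiders n ([3, 1], {(2, 3)}))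
     {P. partition_on {1..n} P \<and> conflict_free True P}"
proof (rule bij_betw_imageI)
  let ?F = "\<lambda>w. set ` set (ltr_cycles w)" and ?S = "arrow_avoiders n ([3, 1], {(2, 3)})"
  have S: "cycle_decomposition (ltr_cycles w) \<and> concat (ltr_cycles w) = w \<and> distinct w \<and> set w = {1..n} \<and>
      (\<forall>B\<in>set (ltr_cycles w). sorted_wrt (>) B) \<and> conflict_free True (?F w)" if "w \<in> ?S" for w
  proof -
    have w: "distinct w" "set w = {1..n}" "\<not> contains_arrow w ([3, 1], {(2, 3)})"
      using that by (auto simp: arrow_avoiders_def permutations_of_set_def)
    with ltr_cycles_decomposition[OF w(1)] contains_arrow_concat_iff[of "ltr_cycles w" n] show ?thesis by simp
  qed
  show "inj_on ?F ?S"
  proof (rule inj_onI)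
    fix v w assume "v \<in> ?S" "w \<in> ?S" "?F v = ?F w"
    then have "ltr_cycles v = ltr_cycles w"
      using S by (intro sorted_blocks_unique) auto
    then show "v = w" using S \<open>v \<in> ?S\<close> \<open>w \<in> ?S\<close> by metis
  qed
  show "?F ` ?S = {P. partition_on {1..n} P \<and> conflict_free True P}"
  proof (intro equalityI subsetI)
    fix P assume "P \<in> ?F ` ?S"
    then obtain w where w: "w \<in> ?S" "P = ?F w" by blast
    have "partition_on {1..n} (?F w)"
      using S[OF w(1)] by (intro partition_on_blocks) (auto simp: cycle_decomposition_def)
    then show "P \<in> {P. partition_on {1..n} P \<and> conflict_free True P}"
      using S[OF w(1)] w(2) by simp
  next
    fix P assume P: "P \<in> {P. partition_on {1..n} P \<and> conflict_free True P}"
    then obtain bs where bs: "cycle_decomposition bs" "\<forall>b\<in>set bs. sorted_wrt (>) b" "set ` set bs = P"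
      "distinct (concat bs)" "set (concat bs) = {1..n}"
      using ex_sorted_blocks by blast
    have "concat bs \<in> ?S"
      using contains_arrow_concat_iff[OF bs(1,4,5)] bs P by (simp add: arrow_avoiders_def permutations_of_set_def)
    then show "P \<in> ?F ` ?S"
      using bs(3) ltr_cycles_concat[OF bs(1)] by (intro rev_image_eqI) auto
  qed
qed

theorem theorem4p4:
  fixes n :: nat
  assumes "n \<ge> 1"
  shows "card (arrow_avoiders n ([3, 1], {(2, 3)})) = bessel_number n"
  using bij_betw_same_card[OF bij_betw_avoiders_partitions] bessel_number_eq by simp

end
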